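(* Consider the generalized Sudoku problem with data $n, \pi_1, \pi_2, \pi_3, i_1, \ldots, i_k, g_{i_1}, \ldots, g_{i_k}$. Let $i \in \{1, \ldots, n^2\}$ be a cell and let $v \in \{1, \ldots, n\}$. The following are equivalent: (i) the cell $i$ is a unicity cell with unique value $v$; (ii) there exists a base set $J \subset \{1, \ldots, n^2\}$ with $i \in J$ such that $i$ is a unicity cell w.r.t. the base set $J$ with unique value $v$.
   Context: For $y \in \mathbb{Z}^s$ write $y <> \mathbf{0}$ if every component of $y$ is nonzero. Let $n \ge 2$ and $s(n) = \sum_{i=1}^{n-1} i$. The $s(n) \times n$ matrix $A(n)$ is defined inductively: $A(1)$ is the empty matrix, and $A(m) = \begin{pmatrix} \mathbf{1}_{m-1} & -U_{m-1} \\ \mathbf{0}_{s(m-1)} & A(m-1) \end{pmatrix}$, where $\mathbf{1}_{m-1}$ is the all-ones column, $U_{m-1}$ the identity matrix and $\mathbf{0}_{s(m-1)}$ the zero column of length $s(m-1)$. Let $A$ be the $(n \cdot s(n)) \times n^2$ block-diagonal matrix whose $n$ diagonal blocks all equal $A(n)$. For a permutation $\pi$ of $\{1,\ldots,n^2\}$, $A_\pi$ is the matrix whose $j$-th column is the $\pi^{-1}(j)$-th column of $A$. Elements of $\{1,\ldots,n^2\}$ are called cells. Generalized Sudoku problem: given permutations $\pi_1, \pi_2, \pi_3$ of $\{1, \ldots, n^2\}$, an integer $0 \le k \le n^2$, an index set $\{i_1, \ldots, i_k\} \subset \{1, \ldots, n^2\}$ and givens $g_{i_l} \in \mathbb{Z}$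 with $1 \le g_{i_l} \le n$, find $x \in \mathbb{Z}^{n^2}$ with $1 \le x_i \le n$ for all $i$, $A_{\pi_r}x <> \mathbf{0}$ for $r = 1,2,3$ and $x_{i_l} = g_{i_l}$ for $l = 1, \ldots, k$. Write the last conditions as $A_{eq}x = g$, where $A_{eq}$ is the $k \times n^2$ matrix whose $l$-th row is the $i_l$-th unit row vector and $g = (g_{i_1}, \ldots, g_{i_k})^T$. Reduced problem: for a base set $J = \{j_1, \ldots, j_p\} \subset \{1,\ldots,n^2\}$ with $1 \le p \le n^2$ and $j_1 < \cdots < j_p$, let $P_J(x) = (x_{j_1}, \ldots, x_{j_p})^T$ and $t_J(j_l) = l$. For a matrix $M$ with $n^2$ columns, $P_J(M)$ keeps the columns $j_1, \ldots, j_p$. Let $B_r$ ($r = 1,2,3$) be obtained from $P_J(A_{\pi_r})$ by deleting all rows with at most one nonzero entry, let $B_{eq}$ be obtained from $P_J(A_{eq})$ by deleting all zero rows, and let $g'$ be obtained from $g$ by deleting the components corresponding to deleted rows of $P_J(A_{eq})$. The reduced problem induced by $J$ is: find $z \in \mathbb{Z}^p$ with $1 \le z_i \le n$ for all $i$, $B_r z <> \mathbf{0}$ for $r = 1,2,3$, and $B_{eq} z = g'$. A cell $i$ is a unicity cell with unique value $v \in \{1,\ldots,n\}$ if every solution $x$ of the generalized Sudoku problem satisfies $x_i = v$. For $i \in J$, the cell $i$ is a unicity cell w.r.t. the base set $J$ with unique value $v$ if every solution $z$ of the reduced problem induced by $J$ satisfies $z_{t_J(i)} = v$. (Solvability is not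 required in either definition.) *)

theory Defs
  imports
    Jordan_Normal_Form.Matrix
    "HOL-Combinatorics.Permutations"
begin

text \<open>
  Cells, column numbers and positions in a vector are counted from 1, as in the mathematics,
  whereas the entries of the types \<open>int vec\<close> and \<open>int mat\<close> are indexed from 0.  The
  shift is made explicit wherever it occurs: component number \<open>c\<close> of \<open>x\<close> is \<open>x $ (c - 1)\<close>.
  Row numbers of matrices are only used internally and are counted from 0.
\<close>

definition cells :: "nat \<Rightarrow> nat set" where
  "cells n = {1..n\<^sup>2}"

definition all_nonzero :: "int vec \<Rightarrow> bool" where
  "all_nonzero y \<longleftrightarrow> (\<forall>j<dim_vec y. y $ j \<noteq> 0)"

definition num_pairs :: "nat \<Rightarrow> nat" where
  "num_pairs n = (\<Sum>i=1..n-1. i)"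

text \<open>
  The empty matrix at size 1 has no rows but one column, so that the recursion yields
  the row \<open>(1, -1)\<close> at size 2.  Size 0 is a dummy case.
\<close>

fun diff_mat :: "nat \<Rightarrow> int mat" where
  "diff_mat 0 = 0\<^sub>m 0 0"
| "diff_mat (Suc 0) = 0\<^sub>m 0 1"
| "diff_mat (Suc (Suc m)) =
     four_block_mat
       (mat (Suc m) 1 (\<lambda>_. 1))         (- 1\<^sub>m (Suc m))
       (0\<^sub>m (num_pairs (Suc m)) 1)     (diff_mat (Suc m))"

definition block_mat :: "nat \<Rightarrow> int mat" where
  "block_mat n = diag_block_mat (replicate n (diff_mat n))"

text \<open>
  \<open>inv_into UNIV \<pi>\<close> is the ordinary inverse of the permutation; the prefix notation for it
  is taken by the group inverse of HOL-Algebra.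
\<close>

definition perm_mat :: "nat \<Rightarrow> (nat \<Rightarrow> nat) \<Rightarrow> int mat" where
  "perm_mat n \<pi> =
     mat_of_cols (dim_row (block_mat n))
       (map (\<lambda>j. col (block_mat n) (inv_into UNIV \<pi> j - 1)) [1..<Suc (n\<^sup>2)])"

text \<open>
  The data of a problem are the size \<open>n\<close>, the permutations \<open>\<pi> 1\<close>, \<open>\<pi> 2\<close>, \<open>\<pi> 3\<close>, the
  number \<open>k\<close> of givens, the cells \<open>ix 1, \<dots>, ix k\<close> and the given values \<open>g (ix 1), \<dots>, g (ix k)\<close>.
\<close>

definition sudoku_data ::
  "nat \<Rightarrow> (nat \<Rightarrow> nat \<Rightarrow> nat) \<Rightarrow> nat \<Rightarrow> (nat \<Rightarrow> nat) \<Rightarrow> (nat \<Rightarrow> int) \<Rightarrow> bool" where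
  "sudoku_data n \<pi> k ix g \<longleftrightarrow>
     2 \<le> n \<and>
     (\<forall>r\<in>{1,2,3}. \<pi> r permutes cells n) \<and>
     k \<le> n\<^sup>2 \<and>
     ix ` {1..k} \<subseteq> cells n \<and> inj_on ix {1..k} \<and>
     (\<forall>l\<in>{1..k}. 1 \<le> g (ix l) \<and> g (ix l) \<le> int n)"

definition sudoku_solution ::
  "nat \<Rightarrow> (nat \<Rightarrow> nat \<Rightarrow> nat) \<Rightarrow> nat \<Rightarrow> (nat \<Rightarrow> nat) \<Rightarrow> (nat \<Rightarrow> int) \<Rightarrow> int vec \<Rightarrow> bool" where
  "sudoku_solution n \<pi> k ix g x \<longleftrightarrow>
     x \<in> carrier_vec (n\<^sup>2) \<and>
     (\<forall>c\<in>cells n. 1 \<le> x $ (c - 1) \<and> x $ (c - 1) \<le> int n) \<and>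
     (\<forall>r\<in>{1,2,3}. all_nonzero (perm_mat n (\<pi> r) *\<^sub>v x)) \<and>
     (\<forall>l\<in>{1..k}. x $ (ix l - 1) = g (ix l))"

definition givens_mat :: "nat \<Rightarrow> nat \<Rightarrow> (nat \<Rightarrow> nat) \<Rightarrow> int mat" where
  "givens_mat n k ix = mat_of_rows (n\<^sup>2) (map (\<lambda>l. unit_vec (n\<^sup>2) (ix l - 1)) [1..<Suc k])"

definition givens_vec :: "nat \<Rightarrow> (nat \<Rightarrow> nat) \<Rightarrow> (nat \<Rightarrow> int) \<Rightarrow> int vec" where
  "givens_vec k ix g = vec_of_list (map (\<lambda>l. g (ix l)) [1..<Suc k])"

definition base_set :: "nat \<Rightarrow> nat set \<Rightarrow> bool" where
  "base_set n J \<longleftrightarrow> J \<subseteq> cells n \<and> 1 \<le> card J \<and> card J \<le> n\<^sup>2"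

text \<open>The element \<open>j\<^sub>l\<close> of \<open>J = {j\<^sub>1 < \<dots> < j\<^sub>p}\<close>, and the position map \<open>j\<^sub>l \<mapsto> l\<close>.\<close>

definition base_elem :: "nat set \<Rightarrow> nat \<Rightarrow> nat" where
  "base_elem J l = sorted_list_of_set J ! (l - 1)"

definition base_pos :: "nat set \<Rightarrow> nat \<Rightarrow> nat" where
  "base_pos J = inv_into {1..card J} (base_elem J)"

definition proj_mat :: "nat set \<Rightarrow> int mat \<Rightarrow> int mat" where
  "proj_mat J M =
     mat_of_cols (dim_row M) (map (\<lambda>l. col M (base_elem J l - 1)) [1..<Suc (card J)])"

definition num_nonzero :: "int vec \<Rightarrow> nat" where
  "num_nonzero v = card {c. c < dim_vec v \<and> v $ c \<noteq> 0}"

definition reduced_mat :: "nat \<Rightarrow> (nat \<Rightarrow> nat) \<Rightarrow> nat set \<Rightarrow> int mat" where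
  "reduced_mat n \<pi> J =
     (let M = proj_mat J (perm_mat n \<pi>)
      in mat_of_rows (dim_col M) (filter (\<lambda>v. \<not> num_nonzero v \<le> 1) (rows M)))"

definition kept_givens :: "nat \<Rightarrow> nat \<Rightarrow> (nat \<Rightarrow> nat) \<Rightarrow> nat set \<Rightarrow> nat list" where
  "kept_givens n k ix J =
     (let M = proj_mat J (givens_mat n k ix)
      in filter (\<lambda>l. row M l \<noteq> 0\<^sub>v (dim_col M)) [0..<dim_row M])"

definition reduced_givens_mat :: "nat \<Rightarrow> nat \<Rightarrow> (nat \<Rightarrow> nat) \<Rightarrow> nat set \<Rightarrow> int mat" where
  "reduced_givens_mat n k ix J =
     (let M = proj_mat J (givens_mat n k ix)
      in mat_of_rows (dim_col M) (map (row M) (kept_givens n k ix J)))"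

definition reduced_givens_vec ::
  "nat \<Rightarrow> nat \<Rightarrow> (nat \<Rightarrow> nat) \<Rightarrow> (nat \<Rightarrow> int) \<Rightarrow> nat set \<Rightarrow> int vec" where
  "reduced_givens_vec n k ix g J =
     vec_of_list (map (\<lambda>l. givens_vec k ix g $ l) (kept_givens n k ix J))"

definition reduced_solution ::
  "nat \<Rightarrow> (nat \<Rightarrow> nat \<Rightarrow> nat) \<Rightarrow> nat \<Rightarrow> (nat \<Rightarrow> nat) \<Rightarrow> (nat \<Rightarrow> int) \<Rightarrow> nat set \<Rightarrow> int vec \<Rightarrow> bool"
where
  "reduced_solution n \<pi> k ix g J z \<longleftrightarrow>
     z \<in> carrier_vec (card J) \<and>
     (\<forall>l\<in>{1..card J}. 1 \<le> z $ (l - 1) \<and> z $ (l - 1) \<le> int n) \<and>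
     (\<forall>r\<in>{1,2,3}. all_nonzero (reduced_mat n (\<pi> r) J *\<^sub>v z)) \<and>
     reduced_givens_mat n k ix J *\<^sub>v z = reduced_givens_vec n k ix g J"

definition unicity_cell ::
  "nat \<Rightarrow> (nat \<Rightarrow> nat \<Rightarrow> nat) \<Rightarrow> nat \<Rightarrow> (nat \<Rightarrow> nat) \<Rightarrow> (nat \<Rightarrow> int) \<Rightarrow> nat \<Rightarrow> int \<Rightarrow> bool" where
  "unicity_cell n \<pi> k ix g i v \<longleftrightarrow>
     (\<forall>x. sudoku_solution n \<pi> k ix g x \<longrightarrow> x $ (i - 1) = v)"

definition unicity_cell_wrt ::
  "nat \<Rightarrow> (nat \<Rightarrow> nat \<Rightarrow> nat) \<Rightarrow> nat \<Rightarrow> (nat \<Rightarrow> nat) \<Rightarrow> (nat \<Rightarrow> int) \<Rightarrow> nat set \<Rightarrow> nat \<Rightarrow> int \<Rightarrow> bool"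
where
  "unicity_cell_wrt n \<pi> k ix g J i v \<longleftrightarrow>
     (\<forall>z. reduced_solution n \<pi> k ix g J z \<longrightarrow> z $ (base_pos J i - 1) = v)"

end

theory Submission
  imports Defs
begin

text \<open>
  Every row of \<open>A\<^sub>\<pi>\<close> has exactly two nonzero entries and every row of \<open>A\<^sub>e\<^sub>q\<close> exactly one.  Hence a row that
  survives the reduction to \<open>J\<close> has lost no nonzero entry, and its product with \<open>P\<^sub>J(x)\<close> is the
  product of the full row with \<open>x\<close>.  So \<open>P\<^sub>J\<close> maps solutions to reduced solutions, whereas for
  \<open>J\<close> the set of all cells nothing is deleted and the two problems coincide.
\<close>

section \<open>Counting the nonzero entries of a vector\<close>

lemma num_nonzero_append: "num_nonzero (v @\<^sub>v w) = num_nonzero v + num_nonzero w"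
proof -
  let ?V = "{c. c < dim_vec v \<and> v $ c \<noteq> 0}" and ?W = "{c. c < dim_vec w \<and> w $ c \<noteq> 0}"
  \<comment> \<open>Concatenation moves the support of \<open>w\<close> behind all indices of
    \<open>v\<close>, so the two parts of the support are disjoint and their sizes add.\<close>
  have "{c. c < dim_vec (v @\<^sub>v w) \<and> (v @\<^sub>v w) $ c \<noteq> 0} = ?V \<union> (\<lambda>c. dim_vec v + c) ` ?W"
  proof (intro Set.set_eqI iffI)
    fix c assume c: "c \<in> {c. c < dim_vec (v @\<^sub>v w) \<and> (v @\<^sub>v w) $ c \<noteq> 0}"
    show "c \<in> ?V \<union> (\<lambda>c. dim_vec v + c) ` ?W"
    proof (cases "c < dim_vec v")
      case False
      then have "c = dim_vec v + (c - dim_vec v)" "c - dim_vec v \<in> ?W"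
        using c by auto
      then show ?thesis by blast
    qed (use c in auto)
  qed auto
  moreover have "?V \<inter> (\<lambda>c. dim_vec v + c) ` ?W = {}" by auto
  ultimately show ?thesis
    by (simp add: num_nonzero_def card_Un_disjoint card_image)
qed

lemma num_nonzero_zero_vec [simp]: "num_nonzero (0\<^sub>v m) = 0"
  by (simp add: num_nonzero_def)

lemma num_nonzero_eq_1:
  assumes "c < dim_vec v" "\<And>j. j < dim_vec v \<Longrightarrow> v $ j \<noteq> 0 \<longleftrightarrow> j = c"
  shows "num_nonzero v = 1"
proof -
  have "{j. j < dim_vec v \<and> v $ j \<noteq> 0} = {c}"
    using assms by blast
  then show ?thesis by (simp add: num_nonzero_def)
qed

lemma num_nonzero_pos:
  assumes "v \<noteq> 0\<^sub>v (dim_vec v)"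
  shows "1 \<le> num_nonzero v"
proof -
  obtain c where "c < dim_vec v" "v $ c \<noteq> 0"
    using assms by (metis eq_vecI index_zero_vec)
  then have "{c. c < dim_vec v \<and> v $ c \<noteq> 0} \<noteq> {}" by blast
  then show ?thesis
    by (simp add: num_nonzero_def Suc_le_eq card_gt_0_iff)
qed

section \<open>Rows of the matrix \<open>A(n)\<close> and of its block-diagonal copy\<close>

lemma num_pairs_Suc: "num_pairs (Suc (Suc m)) = Suc m + num_pairs (Suc m)"
  by (simp add: num_pairs_def)

lemma diff_mat_carrier: "diff_mat n \<in> carrier_mat (num_pairs n) n"
proof (induction n rule: diff_mat.induct)
  case (3 m)
  then show ?case
    by (auto simp: num_pairs_Suc)
qed (auto simp: num_pairs_def)

text \<open>Along the recursion, an upper row consists of the leading 1 and one entry -1 of the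
  negated identity, while a lower row is a row of the smaller matrix with a zero put in
  front.\<close>

lemma num_nonzero_row_diff_mat:
  "r < num_pairs n \<Longrightarrow> num_nonzero (row (diff_mat n) r) = 2"
proof (induction n arbitrary: r rule: diff_mat.induct)
  case (3 m)
  let ?A = "mat (Suc m) 1 (\<lambda>_. 1) :: int mat" and ?B = "- 1\<^sub>m (Suc m) :: int mat"
  let ?C = "0\<^sub>m (num_pairs (Suc m)) 1 :: int mat" and ?D = "diff_mat (Suc m)"
  have carr: "?A \<in> carrier_mat (Suc m) 1" "?B \<in> carrier_mat (Suc m) (Suc m)"
    "?C \<in> carrier_mat (num_pairs (Suc m)) 1" "?D \<in> carrier_mat (num_pairs (Suc m)) (Suc m)"
    using diff_mat_carrier by auto
  show ?case
  proof (cases "r < Suc m")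
    case True
    have "num_nonzero (row ?A r) = 1"
      using True by (intro num_nonzero_eq_1[of 0]) auto
    moreover have "num_nonzero (row ?B r) = 1"
      using True by (intro num_nonzero_eq_1[of r]) auto
    ultimately show ?thesis
      using True row_four_block_mat(1)[OF carr True] by (simp add: num_nonzero_append)
  next
    case False
    then have "r - Suc m < num_pairs (Suc m)"
      using "3.prems" by (simp add: num_pairs_Suc)
    then show ?thesis
      using False "3.IH" "3.prems" row_four_block_mat(2)[OF carr False]
      by (simp add: num_nonzero_append num_pairs_Suc)
  qed
\<comment> \<open>Sizes 0 and 1 have no rows at all.\<close>
qed (auto simp: num_pairs_def)

text \<open>Each row of a block-diagonal matrix is a row of one block padded with zeros, so a count
  shared by all rows of all blocks is inherited.\<close>

lemma num_nonzero_row_diag_block_mat: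
  assumes "\<And>A r. A \<in> set As \<Longrightarrow> r < dim_row A \<Longrightarrow> num_nonzero (row A r) = m"
    and "r < dim_row (diag_block_mat As)"
  shows "num_nonzero (row (diag_block_mat As) r) = m"
  using assms
proof (induction As arbitrary: r)
  case (Cons A As)
  let ?B = "diag_block_mat As"
  have carr: "A \<in> carrier_mat (dim_row A) (dim_col A)"
    "0\<^sub>m (dim_row A) (dim_col ?B) \<in> carrier_mat (dim_row A) (dim_col ?B)"
    "0\<^sub>m (dim_row ?B) (dim_col A) \<in> carrier_mat (dim_row ?B) (dim_col A)"
    "?B \<in> carrier_mat (dim_row ?B) (dim_col ?B)"
    by auto
  show ?case
  proof (cases "r < dim_row A")
    case True
    then show ?thesis
      using Cons.prems row_four_block_mat(1)[OF carr True]
      by (simp add: Let_def num_nonzero_append)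
  next
    case False
    then have "r - dim_row A < dim_row ?B"
      using Cons.prems(2) by (simp add: Let_def)
    then show ?thesis
      using False Cons row_four_block_mat(2)[OF carr False]
      by (simp add: Let_def num_nonzero_append)
  qed
qed simp

lemma dim_col_block_mat: "dim_col (block_mat n) = n\<^sup>2"
  using diff_mat_carrier[of n]
  by (simp add: block_mat_def dim_diag_block_mat power2_eq_square sum_list_replicate)

lemma num_nonzero_row_block_mat:
  "r < dim_row (block_mat n) \<Longrightarrow> num_nonzero (row (block_mat n) r) = 2"
  unfolding block_mat_def
  by (rule num_nonzero_row_diag_block_mat)
    (use diff_mat_carrier[of n] in \<open>auto intro: num_nonzero_row_diff_mat\<close>)

section \<open>Rows of the permuted matrices and of the givens matrix\<close>

lemma perm_mat_carrier: "perm_mat n \<pi> \<in> carrier_mat (dim_row (block_mat n)) (n\<^sup>2)"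
  unfolding perm_mat_def by (rule carrier_matI) (simp_all del: upt_Suc)

text \<open>Permuting columns only rearranges the entries of a row: the inverse permutation, shifted
  to column numbers from 0, carries the support of row \<open>r\<close> of
  \<open>perm_mat n \<pi>\<close> bijectively onto that of row \<open>r\<close> of
  \<open>block_mat n\<close>.\<close>

lemma num_nonzero_row_perm_mat:
  assumes "\<pi> permutes cells n" "r < dim_row (perm_mat n \<pi>)"
  shows "num_nonzero (row (perm_mat n \<pi>) r) = 2"
proof -
  let ?B = "block_mat n" and ?p = "inv_into UNIV \<pi>"
  have r: "r < dim_row ?B" using assms(2) by (simp add: perm_mat_def)
  have p: "?p permutes cells n" using assms(1) by (rule permutes_inv)
  have cell: "Suc c \<in> cells n \<longleftrightarrow> c < n\<^sup>2" for c by (auto simp: cells_def)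
  \<comment> \<open>Positivity matters because subtraction on the naturals truncates: the shift by 1
    preserves injectivity on values that are at least 1.\<close>
  have pos: "0 < ?p (Suc c)" "?p (Suc c) - 1 < n\<^sup>2" if "c < n\<^sup>2" for c
    using permutes_in_image[OF p, of "Suc c"] that by (auto simp: cells_def)
  have entry: "perm_mat n \<pi> $$ (r, c) = ?B $$ (r, ?p (Suc c) - 1)" if "c < n\<^sup>2" for c
    using r that pos[OF that]
    by (simp add: perm_mat_def mat_of_cols_index dim_col_block_mat del: upt_Suc)
  have inj: "inj_on (\<lambda>c. ?p (Suc c) - 1) {..<n\<^sup>2}"
  proof (rule inj_onI)
    fix c d assume "c \<in> {..<n\<^sup>2}" "d \<in> {..<n\<^sup>2}" and eq: "?p (Suc c) - 1 = ?p (Suc d) - 1"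
    then have "?p (Suc c) = ?p (Suc d)" using pos(1)[of c] pos(1)[of d] by simp
    then show "c = d" using permutes_inj[OF p] by (auto dest: injD)
  qed
  have surj: "(\<lambda>c. ?p (Suc c) - 1) ` {..<n\<^sup>2} = {..<n\<^sup>2}"
    using inj pos by (intro card_subset_eq) (auto simp: card_image)
  have "(\<lambda>c. ?p (Suc c) - 1) ` {c. c < n\<^sup>2 \<and> perm_mat n \<pi> $$ (r, c) \<noteq> 0}
      = {c. c < n\<^sup>2 \<and> ?B $$ (r, c) \<noteq> 0}"
  proof (intro Set.set_eqI iffI)
    fix d assume d: "d \<in> {c. c < n\<^sup>2 \<and> ?B $$ (r, c) \<noteq> 0}"
    then obtain c where "c < n\<^sup>2" "d = ?p (Suc c) - 1" using surj by blast
    then show "d \<in> (\<lambda>c. ?p (Suc c) - 1) ` {c. c < n\<^sup>2 \<and> perm_mat n \<pi> $$ (r, c) \<noteq> 0}"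
      using d entry by auto
  qed (use entry pos in auto)
  moreover have "inj_on (\<lambda>c. ?p (Suc c) - 1) {c. c < n\<^sup>2 \<and> perm_mat n \<pi> $$ (r, c) \<noteq> 0}"
    using inj by (rule inj_on_subset) auto
  ultimately have "card {c. c < n\<^sup>2 \<and> perm_mat n \<pi> $$ (r, c) \<noteq> 0}
      = card {c. c < n\<^sup>2 \<and> ?B $$ (r, c) \<noteq> 0}"
    using card_image by fastforce
  then have "num_nonzero (row (perm_mat n \<pi>) r) = num_nonzero (row ?B r)"
    using r perm_mat_carrier[of n \<pi>]
    by (simp add: num_nonzero_def dim_col_block_mat cong: conj_cong)
  then show ?thesis using num_nonzero_row_block_mat[OF r] by simp
qed

lemma givens_mat_carrier: "givens_mat n k ix \<in> carrier_mat k (n\<^sup>2)"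
  unfolding givens_mat_def by (rule carrier_matI) (simp_all del: upt_Suc)

lemma row_givens_mat:
  "l < k \<Longrightarrow> row (givens_mat n k ix) l = unit_vec (n\<^sup>2) (ix (Suc l) - 1)"
  by (simp add: givens_mat_def del: upt_Suc)

lemma num_nonzero_unit_vec: "c < m \<Longrightarrow> num_nonzero (unit_vec m c) = 1"
  by (rule num_nonzero_eq_1[of c]) auto

lemma givens_vec_index: "l < k \<Longrightarrow> givens_vec k ix g $ l = g (ix (Suc l))"
  by (simp add: givens_vec_def vec_of_list_index del: upt_Suc)

section \<open>Enumeration of a base set\<close>

lemma bij_betw_base_elem:
  assumes "finite J"
  shows "bij_betw (base_elem J) {1..card J} J"
proof -
  have "bij_betw (\<lambda>l. l - 1) {1..card J} {..<card J}"
    by (rule bij_betw_byWitness[where f' = Suc]) auto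
  moreover have "bij_betw ((!) (sorted_list_of_set J)) {..<card J} J"
    using assms by (intro bij_betw_nth) auto
  ultimately have "bij_betw ((!) (sorted_list_of_set J) \<circ> (\<lambda>l. l - 1)) {1..card J} J"
    by (rule bij_betw_trans)
  moreover have "base_elem J = (!) (sorted_list_of_set J) \<circ> (\<lambda>l. l - 1)"
    by (simp add: fun_eq_iff base_elem_def)
  ultimately show ?thesis by simp
qed

text \<open>The enumeration counted from 0, the form in which the columns of \<open>proj_mat\<close>
  and the components of \<open>proj_vec\<close> are addressed.\<close>

lemma bij_betw_base_elem_Suc:
  assumes "finite J"
  shows "bij_betw (\<lambda>l. base_elem J (Suc l)) {..<card J} J"
  unfolding base_elem_def using assms by (simp add: bij_betw_nth)

lemma base_elem_pos:
  assumes "finite J" "i \<in> J"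
  shows "base_pos J i \<in> {1..card J}" "base_elem J (base_pos J i) = i"
proof -
  have "i \<in> base_elem J ` {1..card J}"
    using bij_betw_base_elem[OF assms(1)] assms(2) by (simp add: bij_betw_def)
  then show "base_pos J i \<in> {1..card J}" "base_elem J (base_pos J i) = i"
    unfolding base_pos_def by (rule inv_into_into, rule f_inv_into_f)
qed

lemma card_cells: "card (cells n) = n\<^sup>2"
  by (simp add: cells_def)

lemma base_elem_cells:
  assumes "l \<in> {1..n\<^sup>2}"
  shows "base_elem (cells n) l = l"
proof -
  have "sorted_list_of_set (cells n) = [1..<Suc (n\<^sup>2)]"
    using sorted_list_of_set_range[of 1 "Suc (n\<^sup>2)"]
    by (simp only: cells_def atLeastLessThanSuc_atLeastAtMost)
  then show ?thesis
    using assms by (simp add: base_elem_def del: upt_Suc)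
qed

lemma base_pos_cells:
  assumes "i \<in> cells n"
  shows "base_pos (cells n) i = i"
proof -
  have "finite (cells n)" by (simp add: cells_def)
  from base_elem_pos[OF this assms] show ?thesis
    using base_elem_cells[of "base_pos (cells n) i" n] unfolding card_cells by simp
qed

section \<open>Projection of matrices and vectors to a base set\<close>

lemma proj_mat_carrier: "proj_mat J M \<in> carrier_mat (dim_row M) (card J)"
  unfolding proj_mat_def by (rule carrier_matI) (simp_all del: upt_Suc)

lemma proj_mat_index:
  assumes "J \<subseteq> cells n" "dim_col M = n\<^sup>2" "r < dim_row M" "l < card J"
  shows "proj_mat J M $$ (r, l) = M $$ (r, base_elem J (Suc l) - 1)"
proof -
  have "base_elem J (Suc l) \<in> J"
    using assms bij_betw_base_elem_Suc[of J] by (auto simp: bij_betw_def cells_def dest: finite_subset)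
  then have "base_elem J (Suc l) \<in> {1..n\<^sup>2}"
    using assms(1) by (auto simp: cells_def)
  then have "base_elem J (Suc l) - 1 < n\<^sup>2"
    by auto
  then show ?thesis
    using assms by (simp add: proj_mat_def mat_of_cols_index del: upt_Suc)
qed

text \<open>The increasing enumeration of all cells is the identity, so every column is selected and
  stays in its place.\<close>

lemma proj_mat_cells:
  assumes "dim_col M = n\<^sup>2"
  shows "proj_mat (cells n) M = M"
  using assms proj_mat_carrier[of "cells n" M]
  by (intro eq_matI) (auto simp: proj_mat_index[of _ n] card_cells base_elem_cells)

text \<open>The map \<open>P_J\<close> on vectors; \<open>Suc\<close> and \<open>- 1\<close>
  translate between indices from 0 and cells from 1.\<close>

definition proj_vec :: "nat set \<Rightarrow> int vec \<Rightarrow> int vec" where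
  "proj_vec J x = vec (card J) (\<lambda>l. x $ (base_elem J (Suc l) - 1))"

text \<open>Column selection embeds the support of the projected row into the support of the full
  row. By \<open>keep\<close> the supports have equal size, so every nonzero entry of the full row
  is selected and both products add up the same terms over the support.\<close>

lemma scalar_prod_row_proj_mat:
  assumes J: "J \<subseteq> cells n" and M: "dim_col M = n\<^sup>2" and r: "r < dim_row M"
    and x: "x \<in> carrier_vec (n\<^sup>2)"
    and keep: "num_nonzero (row M r) \<le> num_nonzero (row (proj_mat J M) r)"
  shows "row (proj_mat J M) r \<bullet> proj_vec J x = row M r \<bullet> x"
proof -
  let ?b = "\<lambda>l. base_elem J (Suc l) - 1"
  let ?S = "{l. l < card J \<and> M $$ (r, ?b l) \<noteq> 0}" and ?T = "{c. c < n\<^sup>2 \<and> M $$ (r, c) \<noteq> 0}"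
  have "finite J" using J by (auto simp: cells_def dest: finite_subset)
  note bij = bij_betw_base_elem_Suc[OF this]
  have b: "base_elem J (Suc l) \<in> cells n" if "l < card J" for l
    using bij J that by (auto simp: bij_betw_def)
  have inj: "inj_on ?b {..<card J}"
  proof (rule inj_onI)
    fix l m assume "l \<in> {..<card J}" "m \<in> {..<card J}" "?b l = ?b m"
    moreover from this have "base_elem J (Suc l) = base_elem J (Suc m)"
      using b[of l] b[of m] by (auto simp: cells_def)
    ultimately show "l = m" using bij by (auto simp: bij_betw_def dest: inj_onD)
  qed
  then have injS: "inj_on ?b ?S" by (rule inj_on_subset) auto
  have sub: "?b ` ?S \<subseteq> ?T" using b by (force simp: cells_def)
  have "num_nonzero (row M r) = card ?T"
    using M r by (simp add: num_nonzero_def cong: conj_cong)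
  moreover have "num_nonzero (row (proj_mat J M) r) = card ?S"
    using M r J proj_mat_carrier[of J M]
    by (simp add: num_nonzero_def proj_mat_index[of _ n] cong: conj_cong)
  ultimately have im: "?b ` ?S = ?T"
    using keep sub card_image[OF injS] by (intro card_seteq) auto
  have "row (proj_mat J M) r \<bullet> proj_vec J x = (\<Sum>l<card J. M $$ (r, ?b l) * x $ ?b l)"
    using M r J proj_mat_carrier[of J M]
    by (simp add: scalar_prod_def proj_vec_def proj_mat_index[of _ n] atLeast0LessThan)
  also have "\<dots> = (\<Sum>l\<in>?S. M $$ (r, ?b l) * x $ ?b l)"
    by (rule sum.mono_neutral_right) auto
  \<comment> \<open>Reindexing along \<open>?b\<close> reaches all of \<open>?T\<close>, which is
    where the absence of lost entries enters.\<close>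
  also have "\<dots> = (\<Sum>c\<in>?T. M $$ (r, c) * x $ c)"
    unfolding im[symmetric] by (simp only: sum.reindex[OF injS] o_def)
  also have "\<dots> = (\<Sum>c<n\<^sup>2. M $$ (r, c) * x $ c)"
    by (rule sum.mono_neutral_left) auto
  also have "\<dots> = row M r \<bullet> x"
    using M r x by (simp add: scalar_prod_def atLeast0LessThan)
  finally show ?thesis .
qed

section \<open>Reduced constraints, row by row\<close>

lemma mat_of_rows_mult_vec:
  assumes "\<And>v. v \<in> set vs \<Longrightarrow> dim_vec v = m"
  shows "mat_of_rows m vs *\<^sub>v z = vec_of_list (map (\<lambda>v. v \<bullet> z) vs)"
proof (rule eq_vecI)
  fix r assume "r < dim_vec (vec_of_list (map (\<lambda>v. v \<bullet> z) vs))"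
  then have r: "r < length vs" by simp
  then have "row (mat_of_rows m vs) r = vs ! r"
    by (intro mat_of_rows_row carrier_vecI assms nth_mem)
  then show "(mat_of_rows m vs *\<^sub>v z) $ r = vec_of_list (map (\<lambda>v. v \<bullet> z) vs) $ r"
    using r by (simp add: vec_of_list_index del: vec_of_list_map)
qed simp

lemma all_nonzero_mult_iff:
  "all_nonzero (M *\<^sub>v z) \<longleftrightarrow> (\<forall>r<dim_row M. row M r \<bullet> z \<noteq> 0)"
  by (simp add: all_nonzero_def)

lemma all_nonzero_vec_of_list_iff: "all_nonzero (vec_of_list xs) \<longleftrightarrow> 0 \<notin> set xs"
  by (auto simp: all_nonzero_def vec_of_list_index in_set_conv_nth)

text \<open>Filtering renumbers the rows. A guard on the rows of the unfiltered projection keeps the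
  original numbering, in which they can be compared with the rows of
  \<open>perm_mat n \<pi>\<close>.\<close>

lemma all_nonzero_reduced_mat_iff:
  "all_nonzero (reduced_mat n \<pi> J *\<^sub>v z) \<longleftrightarrow>
    (let M = proj_mat J (perm_mat n \<pi>) in
      \<forall>r<dim_row M. 1 < num_nonzero (row M r) \<longrightarrow> row M r \<bullet> z \<noteq> 0)"
proof -
  let ?M = "proj_mat J (perm_mat n \<pi>)"
  have "reduced_mat n \<pi> J *\<^sub>v z
      = vec_of_list (map (\<lambda>v. v \<bullet> z) (filter (\<lambda>v. \<not> num_nonzero v \<le> 1) (rows ?M)))"
    unfolding reduced_mat_def Let_def
    by (rule mat_of_rows_mult_vec) (auto simp: rows_def)
  then show ?thesis
    unfolding Let_def by (auto simp only: all_nonzero_vec_of_list_iff) (force simp: rows_def)+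
qed

text \<open>The list \<open>kept_givens\<close> selects both the rows of the matrix and the
  components of the right-hand side, so the vector equation splits into one equation per kept index.
  \<open>Suc l\<close> turns a row number from 0 into the number of a given.\<close>

lemma reduced_givens_iff:
  "reduced_givens_mat n k ix J *\<^sub>v z = reduced_givens_vec n k ix g J \<longleftrightarrow>
    (let M = proj_mat J (givens_mat n k ix) in
      \<forall>l<k. row M l \<noteq> 0\<^sub>v (dim_col M) \<longrightarrow> row M l \<bullet> z = g (ix (Suc l)))"
proof -
  let ?M = "proj_mat J (givens_mat n k ix)"
  have eq: "reduced_givens_mat n k ix J *\<^sub>v z
      = vec_of_list (map (\<lambda>l. row ?M l \<bullet> z) (kept_givens n k ix J))"
    unfolding reduced_givens_mat_def Let_def
    by (subst mat_of_rows_mult_vec) (auto simp: o_def)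
  \<comment> \<open>\<open>vec_of_list\<close> is injective, since \<open>list_of_vec\<close> is a
    left inverse.\<close>
  have "vec_of_list xs = vec_of_list ys \<longleftrightarrow> xs = ys" for xs ys :: "int list"
    by (metis list_vec)
  then have "vec_of_list (map f xs) = vec_of_list (map h xs) \<longleftrightarrow> (\<forall>l\<in>set xs. f l = h l)"
    for f h :: "nat \<Rightarrow> int" and xs
    by (simp only: map_eq_conv)
  then have "reduced_givens_mat n k ix J *\<^sub>v z = reduced_givens_vec n k ix g J \<longleftrightarrow>
      (\<forall>l\<in>set (kept_givens n k ix J). row ?M l \<bullet> z = givens_vec k ix g $ l)"
    unfolding eq reduced_givens_vec_def .
  moreover have "set (kept_givens n k ix J) = {l. l < k \<and> row ?M l \<noteq> 0\<^sub>v (dim_col ?M)}"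
    using proj_mat_carrier[of J "givens_mat n k ix"] givens_mat_carrier[of n k ix]
    by (auto simp: kept_givens_def Let_def)
  ultimately show ?thesis
    by (auto simp: Let_def givens_vec_index)
qed

section \<open>Transfer of solutions between the two problems\<close>

lemma sudoku_data_ix:
  assumes "sudoku_data n \<pi> k ix g" "l < k"
  shows "ix (Suc l) - 1 < n\<^sup>2"
proof -
  have "ix (Suc l) \<in> cells n"
    using assms by (auto simp: sudoku_data_def)
  then show ?thesis by (auto simp: cells_def)
qed

text \<open>The bounds hold because every component of \<open>proj_vec J x\<close> is a component of
  \<open>x\<close>. Each kept row has all its nonzero entries inside \<open>J\<close>, so
  \<open>scalar_prod_row_proj_mat\<close> carries its condition over.\<close>

lemma reduced_solution_proj_vec:
  assumes data: "sudoku_data n \<pi> k ix g" and J: "J \<subseteq> cells n"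
    and x: "sudoku_solution n \<pi> k ix g x"
  shows "reduced_solution n \<pi> k ix g J (proj_vec J x)"
  unfolding reduced_solution_def
proof (intro conjI ballI)
  have fin: "finite J" using J by (auto simp: cells_def dest: finite_subset)
  have xc: "x \<in> carrier_vec (n\<^sup>2)" using x by (simp add: sudoku_solution_def)
  show "proj_vec J x \<in> carrier_vec (card J)" by (simp add: proj_vec_def)
  {
    fix l assume l: "l \<in> {1..card J}"
    then have "base_elem J l \<in> cells n"
      using bij_betw_base_elem[OF fin] J by (auto simp: bij_betw_def)
    moreover have "proj_vec J x $ (l - 1) = x $ (base_elem J l - 1)"
      using l by (auto simp: proj_vec_def)
    ultimately show "1 \<le> proj_vec J x $ (l - 1)" "proj_vec J x $ (l - 1) \<le> int n"
      using x by (simp_all add: sudoku_solution_def)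
  }
  {
    fix r :: nat assume r: "r \<in> {1,2,3}"
    let ?M = "perm_mat n (\<pi> r)"
    have perm: "\<pi> r permutes cells n" using data r by (auto simp: sudoku_data_def)
    have nz: "row ?M q \<bullet> x \<noteq> 0" if "q < dim_row ?M" for q
      using x r that by (auto simp: sudoku_solution_def all_nonzero_mult_iff)
    \<comment> \<open>More than one nonzero entry means at least two, which is the count of the full
      row.\<close>
    have "row (proj_mat J ?M) q \<bullet> proj_vec J x = row ?M q \<bullet> x"
      if "q < dim_row ?M" "1 < num_nonzero (row (proj_mat J ?M) q)" for q
      using that perm_mat_carrier[of n "\<pi> r"] num_nonzero_row_perm_mat[OF perm that(1)]
      by (intro scalar_prod_row_proj_mat[OF J _ _ xc]) auto
    then show "all_nonzero (reduced_mat n (\<pi> r) J *\<^sub>v proj_vec J x)"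
      using nz proj_mat_carrier[of J ?M] by (auto simp: all_nonzero_reduced_mat_iff Let_def)
  }
  let ?G = "givens_mat n k ix"
  have G: "dim_row ?G = k" "dim_col ?G = n\<^sup>2" using givens_mat_carrier[of n k ix] by auto
  have "row (proj_mat J ?G) l \<bullet> proj_vec J x = g (ix (Suc l))"
    if l: "l < k" and "row (proj_mat J ?G) l \<noteq> 0\<^sub>v (dim_col (proj_mat J ?G))" for l
  proof -
    note ixl = sudoku_data_ix[OF data l]
    \<comment> \<open>One nonzero entry suffices here, because the full row is a unit
      vector.\<close>
    have "1 \<le> num_nonzero (row (proj_mat J ?G) l)"
      using that by (intro num_nonzero_pos) simp
    then have "row (proj_mat J ?G) l \<bullet> proj_vec J x = row ?G l \<bullet> x"
      using l G ixl
      by (intro scalar_prod_row_proj_mat[OF J _ _ xc]) (auto simp: row_givens_mat num_nonzero_unit_vec)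
    also have "\<dots> = x $ (ix (Suc l) - 1)"
      using l ixl xc by (simp add: row_givens_mat scalar_prod_left_unit)
    also have "\<dots> = g (ix (Suc l))"
      using x l by (simp add: sudoku_solution_def)
    finally show ?thesis .
  qed
  then show "reduced_givens_mat n k ix J *\<^sub>v proj_vec J x = reduced_givens_vec n k ix g J"
    by (simp add: reduced_givens_iff Let_def)
qed

text \<open>On all cells the projection is the identity. The rows of the permuted matrices have two
  nonzero entries and the givens rows are unit vectors, so both filters keep every row and the
  constraints are the original ones.\<close>

lemma sudoku_solution_if_reduced_solution_cells:
  assumes data: "sudoku_data n \<pi> k ix g" and z: "reduced_solution n \<pi> k ix g (cells n) z"
  shows "sudoku_solution n \<pi> k ix g z"
  unfolding sudoku_solution_def
proof (intro conjI ballI)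
  show zc: "z \<in> carrier_vec (n\<^sup>2)"
    using z by (simp add: reduced_solution_def card_cells)
  show "1 \<le> z $ (c - 1)" "z $ (c - 1) \<le> int n" if "c \<in> cells n" for c
    using z that unfolding reduced_solution_def card_cells by (auto simp: cells_def)
  show "all_nonzero (perm_mat n (\<pi> r) *\<^sub>v z)" if r: "r \<in> {1,2,3}" for r
  proof -
    have "\<pi> r permutes cells n" using data r by (auto simp: sudoku_data_def)
    moreover have "all_nonzero (reduced_mat n (\<pi> r) (cells n) *\<^sub>v z)"
      using z r by (auto simp: reduced_solution_def)
    moreover have "proj_mat (cells n) (perm_mat n (\<pi> r)) = perm_mat n (\<pi> r)"
      using perm_mat_carrier[of n "\<pi> r"] by (intro proj_mat_cells) auto
    ultimately show ?thesis
      unfolding all_nonzero_reduced_mat_iff all_nonzero_mult_iff[of "perm_mat n (\<pi> r)"] Let_def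
      by (simp add: num_nonzero_row_perm_mat)
  qed
  show "z $ (ix l - 1) = g (ix l)" if "l \<in> {1..k}" for l
  proof -
    \<comment> \<open>\<open>m\<close> is the row number, counted from 0, of the given number
      \<open>l\<close>.\<close>
    define m where "m = l - 1"
    then have m: "l = Suc m" "m < k" using that by auto
    note ixm = sudoku_data_ix[OF data m(2)]
    have G: "dim_col (givens_mat n k ix) = n\<^sup>2"
      using givens_mat_carrier[of n k ix] by auto
    have "reduced_givens_mat n k ix (cells n) *\<^sub>v z = reduced_givens_vec n k ix g (cells n)"
      using z by (simp add: reduced_solution_def)
    moreover have "unit_vec (n\<^sup>2) (ix (Suc m) - 1) \<noteq> (0\<^sub>v (n\<^sup>2) :: int vec)"
      using ixm by simp
    ultimately have "unit_vec (n\<^sup>2) (ix (Suc m) - 1) \<bullet> z = g (ix (Suc m))"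
      using m(2) row_givens_mat[OF m(2), of n ix] G
      unfolding reduced_givens_iff proj_mat_cells[OF G] Let_def by metis
    then show ?thesis
      using ixm zc m(1) by (simp add: scalar_prod_left_unit)
  qed
qed

theorem theorem5p1:
  fixes n k i :: nat
    and \<pi> :: "nat \<Rightarrow> nat \<Rightarrow> nat"
    and ix :: "nat \<Rightarrow> nat"
    and g :: "nat \<Rightarrow> int"
    and v :: int
  assumes "sudoku_data n \<pi> k ix g"
    and "i \<in> cells n"
    and "v \<in> {1..int n}"
  shows "unicity_cell n \<pi> k ix g i v \<longleftrightarrow>
    (\<exists>J. base_set n J \<and> i \<in> J \<and> unicity_cell_wrt n \<pi> k ix g J i v)"
proof
  assume "unicity_cell n \<pi> k ix g i v"
  \<comment> \<open>The witness for \<open>J\<close> is the set of all cells, where the position of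
    \<open>i\<close> is \<open>i\<close> itself.\<close>
  then have "unicity_cell_wrt n \<pi> k ix g (cells n) i v"
    using sudoku_solution_if_reduced_solution_cells[OF assms(1)] assms(2)
    by (simp add: unicity_cell_def unicity_cell_wrt_def base_pos_cells)
  moreover have "base_set n (cells n)"
    using assms(1) by (simp add: base_set_def card_cells sudoku_data_def)
  ultimately show "\<exists>J. base_set n J \<and> i \<in> J \<and> unicity_cell_wrt n \<pi> k ix g J i v"
    using assms(2) by blast
next
  assume "\<exists>J. base_set n J \<and> i \<in> J \<and> unicity_cell_wrt n \<pi> k ix g J i v"
  then obtain J where J: "J \<subseteq> cells n" "i \<in> J" and u: "unicity_cell_wrt n \<pi> k ix g J i v"
    by (auto simp: base_set_def)
  have fin: "finite J" using J(1) by (auto simp: cells_def dest: finite_subset)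
  \<comment> \<open>As \<open>i\<close> is element number \<open>base_pos J i\<close> of
    \<open>J\<close>, the projection stores component \<open>i\<close> of \<open>x\<close> exactly
    at the position that the reduced problem inspects.\<close>
  have "proj_vec J x $ (base_pos J i - 1) = x $ (i - 1)" for x
    using base_elem_pos[OF fin J(2)] by (auto simp: proj_vec_def)
  then show "unicity_cell n \<pi> k ix g i v"
    using u reduced_solution_proj_vec[OF assms(1) J(1)]
    unfolding unicity_cell_def unicity_cell_wrt_def by metis
qed

end
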